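(* Let $N\ge1$ be an integer, $p>1$, $q>1$, $\alpha>0$. Assume that either $p>2$, or $p<2$ and $\alpha<\frac{p}{2-p}$. For any solution $w$ of $$(|w'|^{p-2}w')'+\frac{N-1}{r}|w'|^{p-2}w'+rw'+\alpha w+|w|^{q-1}w=0,\qquad (E)$$ there exists $L\in\mathbb{R}$ such that $\lim_{r\to\infty}r^\alpha w(r)=L$.
   Context: A solution of (E) is a function $w\in C^1((R_w,\infty))$, for some $R_w\ge0$, with $|w'|^{p-2}w'\in C^1((R_w,\infty))$, satisfying (E) on $(R_w,\infty)$. *)

theory Defs
  imports "HOL-Analysis.Analysis"
begin

(* |s|^(p-2) s, with value 0 at s = 0 also when p < 2 (powr has 0 powr a = 0 for every a). *)
definition p_flux :: "real \<Rightarrow> real \<Rightarrow> real" where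
  "p_flux p s = \<bar>s\<bar> powr (p - 2) * s"

(* w is a total function, but only its values on the open set {R<..} are constrained. *)
definition solution_on_ray ::
    "nat \<Rightarrow> real \<Rightarrow> real \<Rightarrow> real \<Rightarrow> real \<Rightarrow> (real \<Rightarrow> real) \<Rightarrow> bool" where
  "solution_on_ray N p q \<alpha> R w \<longleftrightarrow>
     w C1_differentiable_on {R<..} \<and>
     (\<lambda>r. p_flux p (deriv w r)) C1_differentiable_on {R<..} \<and>
     (\<forall>r>R. deriv (\<lambda>s. p_flux p (deriv w s)) r
            + (real N - 1) / r * p_flux p (deriv w r)
            + r * deriv w r + \<alpha> * w r + \<bar>w r\<bar> powr (q - 1) * w r = 0)"

definition is_solution ::
    "nat \<Rightarrow> real \<Rightarrow> real \<Rightarrow> real \<Rightarrow> (real \<Rightarrow> real) \<Rightarrow> bool" where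
  "is_solution N p q \<alpha> w \<longleftrightarrow> (\<exists>R\<ge>0. solution_on_ray N p q \<alpha> R w)"

end

theory Submission
  imports Defs
begin

text \<open>With \<open>\<phi> = \<bar>w'\<bar>\<^sup>p\<^sup>-\<^sup>2 w'\<close>, a decreasing energy shows that \<open>w\<close> and \<open>w'\<close> are bounded. A decay
  \<open>w = O(r powr (- \<gamma>))\<close> gives by a barrier argument \<open>\<phi> / r = O(r powr (- \<gamma> - \<delta>))\<close> with
  \<open>\<delta> = \<gamma> * (p - 2) + p\<close>, and the hypothesis on \<open>p\<close> and \<open>\<alpha>\<close> makes \<open>\<delta>\<close> positive for all
  \<open>\<gamma> \<le> \<alpha>\<close>. The quantity \<open>u = w + \<phi> / r\<close> satisfies
  \<open>r u' = - \<alpha> u + (\<alpha> - N) \<phi> / r - \<bar>w\<bar>\<^sup>q\<^sup>-\<^sup>1 w\<close>. After multiplication by \<open>u\<close> the source term has a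
  good sign up to a factor \<open>\<phi> / r\<close>, so a Gronwall estimate of \<open>u\<^sup>2\<close> improves the decay exponent by
  a fixed amount, even from \<open>\<gamma> = 0\<close>. Iterating reaches every
  \<open>\<gamma> < \<alpha>\<close>; for \<open>\<gamma>\<close> near \<open>\<alpha>\<close> the derivative of \<open>r powr \<alpha> * u r\<close> is integrable at
  infinity because \<open>q > 1\<close>.\<close>

section \<open>Algebra and calculus of the flux map\<close>

lemma abs_p_flux: "\<bar>p_flux p s\<bar> = \<bar>s\<bar> powr (p - 1)"
proof (cases "s = 0")
  case False
  then have "\<bar>s\<bar> powr (p - 2) * \<bar>s\<bar> powr 1 = \<bar>s\<bar> powr (p - 1)"
    by (subst powr_add[symmetric]) simp
  then show ?thesis using False by (simp add: p_flux_def abs_mult)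
qed (simp add: p_flux_def)

lemma p_flux_pos: "x > 0 \<Longrightarrow> p_flux p x = x powr (p - 1)"
  using abs_p_flux[of p x] by (simp add: p_flux_def)

lemma p_flux_minus [simp]: "p_flux p (- s) = - p_flux p s"
  by (simp add: p_flux_def)

lemma mult_p_flux: "s * p_flux p s = \<bar>s\<bar> powr p"
proof (cases "s = 0")
  case False
  then have "\<bar>s\<bar> powr p = \<bar>s\<bar> powr (p - 2) * \<bar>s\<bar> powr 2"
    by (subst powr_add[symmetric]) simp
  then show ?thesis by (simp add: p_flux_def power2_eq_square)
qed (simp add: p_flux_def)

text \<open>Flux maps of conjugate exponents are mutually inverse, since the powers of
  \<open>\<bar>s\<bar>\<close> cancel. This recovers \<open>w'\<close> from the flux, both in the
  energy identity and where the flux meets its barrier.\<close>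

lemma p_flux_conjugate:
  assumes "p > 1"
  shows "p_flux (p / (p - 1)) (p_flux p s) = s"
proof (cases "s = 0")
  case False
  have "(p - 1) * (p / (p - 1) - 2) + (p - 2) = 0"
    using assms by (simp add: field_simps)
  then have "\<bar>s\<bar> powr ((p - 1) * (p / (p - 1) - 2)) * \<bar>s\<bar> powr (p - 2) = 1"
    using False by (subst powr_add[symmetric]) simp
  then show ?thesis
    unfolding p_flux_def[of "p / (p - 1)"] abs_p_flux powr_powr
    by (simp add: p_flux_def)
qed (simp add: p_flux_def)

text \<open>Away from zero this is the power rule on either half-line; at zero the difference
  quotient has absolute value \<open>\<bar>h\<bar> powr (s - 1)\<close>, which vanishes because
  \<open>s > 1\<close>. Zeros of \<open>w\<close> and \<open>w'\<close> thus cause no trouble in the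
  energy.\<close>

lemma has_real_derivative_abs_powr:
  assumes "s > 1"
  shows "((\<lambda>x. \<bar>x\<bar> powr s) has_real_derivative s * p_flux s x) (at x)"
proof -
  consider "x > 0" | "x < 0" | "x = 0" by linarith
  then show ?thesis
  proof cases
    case 1
    have "((\<lambda>x. x powr s) has_real_derivative s * x powr (s - 1)) (at x)"
      using 1 by (rule has_real_derivative_powr)
    moreover have "eventually (\<lambda>y. \<bar>y\<bar> powr s = y powr s) (nhds x)"
      using 1
      by (intro eventually_mono[OF eventually_nhds_in_open[of "{0<..}"]]) auto
    ultimately show ?thesis
      using 1 by (simp add: DERIV_cong_ev p_flux_pos)
  next
    case 2
    have "((\<lambda>x. (- x) powr s) has_real_derivative s * (- x) powr (s - 1) * (- 1)) (at x)"
      using 2 by (intro DERIV_chain2[where f="\<lambda>x. x powr s" and g=uminus]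
          has_real_derivative_powr derivative_eq_intros) auto
    moreover have "eventually (\<lambda>y. \<bar>y\<bar> powr s = (- y) powr s) (nhds x)"
      using 2 by (intro eventually_mono[OF eventually_nhds_in_open[of "{..<0}"]]) auto
    moreover have "p_flux s x = - ((- x) powr (s - 1))"
      using 2 p_flux_pos[of "- x" s] by simp
    ultimately show ?thesis
      by (simp add: DERIV_cong_ev)
  next
    case 3
    have "((\<lambda>h. \<bar>h\<bar> powr (s - 1)) \<longlongrightarrow> \<bar>0\<bar> powr (s - 1)) (at (0::real))"
      using assms by (intro tendsto_intros) auto
    then have "((\<lambda>h::real. \<bar>\<bar>h\<bar> powr s / h\<bar>) \<longlongrightarrow> 0) (at 0)"
      by (rule Lim_transform_eventually[THEN tendsto_eq_rhs])
        (auto simp: powr_diff eventually_at_filter)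
    then have "((\<lambda>h::real. \<bar>h\<bar> powr s / h) \<longlongrightarrow> 0) (at 0)"
      by (rule tendsto_rabs_zero_cancel)
    then show ?thesis using 3 by (simp add: DERIV_def p_flux_def)
  qed
qed

section \<open>Comparison and convergence on a half-line\<close>

text \<open>At the first point \<open>c\<close> with \<open>f c \<ge> 0\<close> the value is zero,
  so the derivative there is negative and \<open>f\<close> is positive just to the left of
  \<open>c\<close>, contradicting minimality.\<close>

lemma stays_negative:
  fixes f f' :: "real \<Rightarrow> real"
  assumes deriv: "\<And>r. r \<ge> a \<Longrightarrow> (f has_real_derivative f' r) (at r)"
    and start: "f a < 0"
    and cross: "\<And>r. r \<ge> a \<Longrightarrow> f r = 0 \<Longrightarrow> f' r < 0"
    and "r \<ge> a"
  shows "f r < 0"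
proof (rule ccontr)
  assume "\<not> f r < 0"
  have cont: "continuous_on {a..t} f" for t
    by (intro continuous_at_imp_continuous_on ballI DERIV_isCont[OF deriv]) auto
  define S where "S = {a..r} \<inter> f -` {0..}"
  have "closed S"
    unfolding S_def by (intro continuous_closed_preimage cont) auto
  moreover have S: "S \<noteq> {}" "bdd_below S"
    using \<open>\<not> f r < 0\<close> \<open>r \<ge> a\<close> by (auto simp: S_def bdd_below_def)
  ultimately have c: "Inf S \<in> S"
    by (intro closed_contains_Inf)
  define c where "c = Inf S"
  have least: "f x < 0" if "a \<le> x" "x < c" for x
    using cInf_lower[OF _ S(2), of x] that c by (force simp: S_def c_def)
  have ac: "a < c"
    using c start by (cases "Inf S = a") (auto simp: S_def c_def)
  have "f c \<ge> 0" "c \<ge> a"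
    using c by (auto simp: S_def c_def)
  then obtain x where "a \<le> x" "x \<le> c" "f x = 0"
    using IVT'[of f a 0 c] start cont by auto
  then have "f c = 0"
    using least[of x] by (cases "x = c") auto
  then obtain d where "d > 0" and d: "\<And>h. h > 0 \<Longrightarrow> h < d \<Longrightarrow> f (c - h) > f c"
    using DERIV_neg_dec_left[OF deriv cross] \<open>c \<ge> a\<close> by blast
  define h where "h = min (d / 2) (c - a)"
  have "h > 0" "h < d" "h \<le> c - a"
    using \<open>d > 0\<close> ac by (auto simp: h_def)
  then show False
    using d[of h] least[of "c - h"] \<open>f c = 0\<close> by simp
qed

lemma antimono_of_deriv_nonpos:
  fixes f f' :: "real \<Rightarrow> real"
  assumes deriv: "\<And>r. r \<ge> a \<Longrightarrow> (f has_real_derivative f' r) (at r)"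
    and nonpos: "\<And>r. r \<ge> a \<Longrightarrow> f' r \<le> 0"
    and "a \<le> x" "x \<le> y"
  shows "f y \<le> f x"
  using \<open>x \<le> y\<close>
proof (rule DERIV_nonpos_imp_nonincreasing)
  fix t assume "x \<le> t" "t \<le> y"
  then show "\<exists>z. DERIV f t :> z \<and> z \<le> 0"
    using deriv[of t] nonpos[of t] \<open>a \<le> x\<close> by auto
qed

lemma convergent_of_antimono_bounded:
  fixes f :: "real \<Rightarrow> real"
  assumes mono: "\<And>x y. a \<le> x \<Longrightarrow> x \<le> y \<Longrightarrow> f y \<le> f x"
    and bound: "\<And>x. a \<le> x \<Longrightarrow> B \<le> f x"
  shows "\<exists>L. (f \<longlongrightarrow> L) at_top"
proof -
  define L where "L = Inf (f ` {a..})"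
  have bdd: "bdd_below (f ` {a..})"
    using bound by (auto simp: bdd_below_def)
  have "(f \<longlongrightarrow> L) at_top"
  proof (rule order_tendstoI)
    fix l assume "l < L"
    have "L \<le> f x" if "x \<ge> a" for x
      unfolding L_def using that by (intro cInf_lower bdd) auto
    then show "\<forall>\<^sub>F x in at_top. l < f x"
      using \<open>l < L\<close> by (intro eventually_mono[OF eventually_ge_at_top[of a]]) force
  next
    fix l assume "L < l"
    then obtain x where x: "x \<ge> a" "f x < l"
      using cInf_lessD[of "f ` {a..}" l] by (auto simp: L_def)
    show "\<forall>\<^sub>F x in at_top. f x < l"
      using mono[OF x(1)] x(2)
      by (intro eventually_mono[OF eventually_ge_at_top[of x]]) force
  qed
  then show ?thesis ..
qed

text \<open>The function \<open>b\<close>, a primitive of the negated bound, tends to 0 and replaces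
  integration: \<open>f + b\<close> and \<open>b - f\<close> are both nonincreasing, the second
  bounds the first from below, and so \<open>f + b\<close> converges.\<close>

lemma convergent_of_deriv_bound:
  fixes f f' :: "real \<Rightarrow> real"
  assumes "a > 0" "\<eta> > 0" "C \<ge> 0"
    and deriv: "\<And>r. r \<ge> a \<Longrightarrow> (f has_real_derivative f' r) (at r)"
    and bound: "\<And>r. r \<ge> a \<Longrightarrow> \<bar>f' r\<bar> \<le> C * r powr (- 1 - \<eta>)"
  shows "\<exists>L. (f \<longlongrightarrow> L) at_top"
proof -
  define b where "b = (\<lambda>r. C / \<eta> * r powr (- \<eta>))"
  have b: "(b has_real_derivative - (C * r powr (- 1 - \<eta>))) (at r)" if "r \<ge> a" for r
  proof -
    have "- \<eta> - 1 = - 1 - \<eta>" by simp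
    then show ?thesis
      unfolding b_def using \<open>a > 0\<close> \<open>\<eta> > 0\<close> that
      by (auto intro!: derivative_eq_intros has_real_derivative_powr simp: minus_diff_commute)
  qed
  have b_nonneg: "b r \<ge> 0" for r
    using \<open>\<eta> > 0\<close> \<open>C \<ge> 0\<close> by (simp add: b_def)
  have plus: "f y + b y \<le> f x + b x" if "a \<le> x" "x \<le> y" for x y
  proof (rule antimono_of_deriv_nonpos[where f="\<lambda>r. f r + b r", OF DERIV_add[OF deriv b] _ that])
    show "f' r + - (C * r powr (- 1 - \<eta>)) \<le> 0" if "a \<le> r" for r
      using bound[OF that] by linarith
  qed
  have minus: "b y - f y \<le> b x - f x" if "a \<le> x" "x \<le> y" for x y
  proof (rule antimono_of_deriv_nonpos[where f="\<lambda>r. b r - f r", OF DERIV_diff[OF b deriv] _ that])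
    show "- (C * r powr (- 1 - \<eta>)) - f' r \<le> 0" if "a \<le> r" for r
      using bound[OF that] by linarith
  qed
  have "f a - b a \<le> f x + b x" if "a \<le> x" for x
    using minus[OF order_refl that] b_nonneg[of x] by linarith
  then obtain L where "((\<lambda>r. f r + b r) \<longlongrightarrow> L) at_top"
    using convergent_of_antimono_bounded[of a "\<lambda>r. f r + b r", OF plus] by blast
  moreover have "(b \<longlongrightarrow> C / \<eta> * 0) at_top"
    unfolding b_def using \<open>\<eta> > 0\<close>
    by (intro tendsto_mult tendsto_const tendsto_neg_powr filterlim_ident) auto
  ultimately have "((\<lambda>r. f r + b r - b r) \<longlongrightarrow> L - C / \<eta> * 0) at_top"
    by (rule tendsto_diff)
  then show ?thesis by auto
qed

section \<open>Barrier estimate for the flux\<close>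

text \<open>The barrier for \<open>v\<close> is \<open>K * r powr (- \<gamma> - 1)\<close>. Taking \<open>K\<close> proportional to
  \<open>r0 powr (\<gamma> + 1)\<close> puts the starting point below it for every large \<open>r0\<close>, and makes the crossing
  condition scale like \<open>r0\<^sup>2\<close> whether \<open>p\<close> is above or below 2.\<close>

lemma flux_upper_decay:
  fixes v \<phi> h :: "real \<Rightarrow> real"
  assumes "p > 1" "n \<ge> 0" "\<gamma> \<ge> 0" "\<gamma> * (p - 2) + p \<ge> 0" "a > 0" "C \<ge> 0" "M \<ge> 0"
    and flux: "\<And>r. r \<ge> a \<Longrightarrow> \<phi> r = p_flux p (v r)"
    and deriv: "\<And>r. r \<ge> a \<Longrightarrow>
      (\<phi> has_real_derivative - (n / r * \<phi> r + r * v r + h r)) (at r)"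
    and v_bound: "\<And>r. r \<ge> a \<Longrightarrow> \<bar>v r\<bar> \<le> M"
    and h_bound: "\<And>r. r \<ge> a \<Longrightarrow> \<bar>h r\<bar> \<le> C * r powr (- \<gamma>)"
  shows "\<exists>K r0. \<forall>r\<ge>r0. \<phi> r \<le> K * r powr (- (\<gamma> + 1) * (p - 1))"
proof -
  \<comment> \<open>The part \<open>M + 1\<close> puts \<open>\<bar>v r0\<bar>\<close> strictly
    below the barrier value \<open>D\<close> at \<open>r0\<close>; the part \<open>2 * C\<close>
    lets half of \<open>K\<close> absorb \<open>h\<close>.\<close>
  define D where "D = M + 1 + 2 * C"
  define e where "e = (\<gamma> + 1) * (p - 1)"
  have "D > 0" "e \<ge> 0" using assms by (auto simp: D_def e_def)
  obtain r0 where r0: "r0 \<ge> max 1 a" "r0 > 2 * (D powr (p - 2) * e)"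
    by (metis less_add_one linorder_not_le max.cobounded1 max.cobounded2 order_less_imp_le
        order_le_less_trans)
  have "r0 \<ge> 1" "r0 \<ge> a" "r0 > 0" using r0 by auto
  define K where "K = D * r0 powr (\<gamma> + 1)"
  have "r0 powr (\<gamma> + 1) \<ge> 1"
    using \<open>r0 \<ge> 1\<close> \<open>\<gamma> \<ge> 0\<close> by (intro ge_one_powr_ge_zero) auto
  then have "K \<ge> D" "K > 0"
    using \<open>D > 0\<close> \<open>r0 > 0\<close> by (auto simp: K_def)
  define B where "B = (\<lambda>r. K powr (p - 1) * r powr (- e))"
  \<comment> \<open>\<open>B\<close> is the flux of the barrier for \<open>v\<close>, so the
    comparison can be made for \<open>\<phi>\<close>, whose derivative is known.\<close>
  have B: "B r = p_flux p (K * r powr (- \<gamma> - 1))" if "r > 0" for r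
  proof -
    have "(- \<gamma> - 1) * (p - 1) = - e" by (simp add: e_def algebra_simps)
    then show ?thesis
      using that \<open>K > 0\<close> by (simp add: B_def p_flux_pos powr_mult powr_powr)
  qed
  have negative: "\<phi> r - B r < 0" if "r \<ge> r0" for r
  proof (rule stays_negative[where f="\<lambda>r. \<phi> r - B r" and a=r0])
    show "((\<lambda>r. \<phi> r - B r) has_real_derivative
        - (n / r * \<phi> r + r * v r + h r) + K powr (p - 1) * (e * r powr (- e - 1))) (at r)"
      if "r \<ge> r0" for r
      using that \<open>r0 \<ge> a\<close> \<open>r0 > 0\<close> unfolding B_def
      by (auto intro!: derivative_eq_intros deriv has_real_derivative_powr)
    show "\<phi> r0 - B r0 < 0"
    proof -
      have "K * r0 powr (- \<gamma> - 1) = D"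
        using \<open>r0 > 0\<close> by (simp add: K_def powr_add[symmetric] mult.assoc)
      then have "B r0 = D powr (p - 1)"
        using B[of r0] \<open>r0 > 0\<close> \<open>D > 0\<close> by (simp add: p_flux_pos)
      moreover have "\<phi> r0 \<le> \<bar>v r0\<bar> powr (p - 1)"
        using flux[of r0] \<open>r0 \<ge> a\<close> abs_p_flux[of p "v r0"] by simp
      moreover have "\<bar>v r0\<bar> powr (p - 1) < D powr (p - 1)"
        using v_bound[of r0] \<open>r0 \<ge> a\<close> \<open>p > 1\<close> \<open>C \<ge> 0\<close>
        by (intro powr_less_mono2) (auto simp: D_def)
      ultimately show ?thesis by linarith
    qed
    show "- (n / r * \<phi> r + r * v r + h r) + K powr (p - 1) * (e * r powr (- e - 1)) < 0"
      if r: "r \<ge> r0" and zero: "\<phi> r - B r = 0" for r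
    proof -
      have "r > 0" using r \<open>r0 > 0\<close> by simp
      have "\<phi> r \<ge> 0" using zero by (simp add: B_def)
      have "p_flux p (v r) = p_flux p (K * r powr (- \<gamma> - 1))"
        using zero flux[of r] B[of r] r \<open>r0 \<ge> a\<close> \<open>r > 0\<close> by simp
      then have v: "v r = K * r powr (- \<gamma> - 1)"
        using p_flux_conjugate[OF \<open>p > 1\<close>] by metis
      have rv: "r * v r = K * r powr (- \<gamma>)"
        using \<open>r > 0\<close> by (simp add: v powr_diff)
      have h: "- h r \<le> K / 2 * r powr (- \<gamma>)"
      proof -
        have "C \<le> K / 2" using \<open>K \<ge> D\<close> \<open>M \<ge> 0\<close> by (simp add: D_def)
        then have "C * r powr (- \<gamma>) \<le> K / 2 * r powr (- \<gamma>)"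
          by (rule mult_right_mono) simp
        then show ?thesis
          using h_bound[of r] r \<open>r0 \<ge> a\<close> by auto
      qed
      \<comment> \<open>At a crossing \<open>r * v r\<close> equals
        \<open>K * r powr (- \<gamma>)\<close>. One half of it controls \<open>h\<close>; the next
        inequality says that the other half beats the derivative of the barrier, once common powers
        of \<open>K\<close> and \<open>r\<close> are divided out.\<close>
      define d where "d = \<gamma> * (p - 2) + p"
      have "K powr (p - 2) * e < r powr d / 2"
      proof -
        have "K powr (p - 2) = D powr (p - 2) * r0 powr ((\<gamma> + 1) * (p - 2))"
          using \<open>D > 0\<close> by (simp add: K_def powr_mult powr_powr)
        also have "(\<gamma> + 1) * (p - 2) = d - 2" by (simp add: d_def algebra_simps)
        finally have "K powr (p - 2) * e = D powr (p - 2) * e * r0 powr (d - 2)" by simp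
        also have "\<dots> < r0 / 2 * r0 powr (d - 2)"
          using r0 \<open>r0 > 0\<close> by (intro mult_strict_right_mono) auto
        also have "\<dots> = r0 powr (d - 1) / 2"
          using \<open>r0 > 0\<close> by (simp add: powr_diff power2_eq_square)
        also have "\<dots> \<le> r0 powr d / 2"
          using \<open>r0 \<ge> 1\<close> by (simp add: powr_mono)
        also have "\<dots> \<le> r powr d / 2"
          using r \<open>r0 > 0\<close> assms(4) by (simp add: d_def powr_mono2)
        finally show ?thesis .
      qed
      then have "K powr (p - 2) * e * (K * r powr (- e - 1)) < r powr d / 2 * (K * r powr (- e - 1))"
        using \<open>K > 0\<close> \<open>r > 0\<close> by (intro mult_strict_right_mono) auto
      moreover have "K powr (p - 1) = K powr (p - 2) * K"
        using \<open>K > 0\<close> powr_add[of K "p - 2" 1] by simp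
      moreover have "r powr d * r powr (- e - 1) = r powr (- \<gamma>)"
        using \<open>r > 0\<close> by (simp add: powr_add[symmetric] d_def e_def algebra_simps)
      ultimately have "K powr (p - 1) * (e * r powr (- e - 1)) < K / 2 * r powr (- \<gamma>)"
        by (simp add: mult.assoc mult.left_commute mult.commute)
      moreover have "n / r * \<phi> r \<ge> 0"
        using \<open>r > 0\<close> \<open>n \<ge> 0\<close> \<open>\<phi> r \<ge> 0\<close> by simp
      ultimately show ?thesis
        using rv h by linarith
    qed
  qed (rule that)
  show ?thesis
    using negative by (intro exI[of _ "K powr (p - 1)"] exI[of _ r0])
      (auto simp: B_def e_def less_imp_le algebra_simps)
qed

section \<open>Landau bounds by powers of \<open>r\<close>\<close>

text \<open>The free parameter \<open>c\<close> pushes the threshold past the start of the ray on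
  which the differential equation holds.\<close>

lemma bigo_powrE:
  fixes f :: "real \<Rightarrow> real"
  assumes "f \<in> O(\<lambda>r. r powr s)"
  obtains C b where "C \<ge> 0" "b \<ge> c" "b \<ge> 1" "\<And>r. r \<ge> b \<Longrightarrow> \<bar>f r\<bar> \<le> C * r powr s"
proof -
  obtain C where C: "C > 0" "\<forall>\<^sub>F r in at_top. norm (f r) \<le> C * norm (r powr s)"
    using assms by (rule landau_o.bigE)
  then obtain b where b: "\<And>r. r \<ge> b \<Longrightarrow> \<bar>f r\<bar> \<le> C * r powr s"
    by (auto simp: eventually_at_top_linorder)
  show thesis
    by (rule that[of C "max b (max c 1)"]) (use C b in auto)
qed

lemma bigo_powrI:
  fixes f :: "real \<Rightarrow> real"
  assumes "\<And>r. r \<ge> b \<Longrightarrow> \<bar>f r\<bar> \<le> C * r powr s"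
  shows "f \<in> O(\<lambda>r. r powr s)"
  by (rule bigoI[of _ C])
    (use assms in \<open>auto intro!: eventually_mono[OF eventually_ge_at_top[of b]]\<close>)

lemma bigo_powr_mono:
  fixes f :: "real \<Rightarrow> real"
  assumes "f \<in> O(\<lambda>r. r powr s)" "s \<le> t"
  shows "f \<in> O(\<lambda>r. r powr t)"
proof -
  obtain C b where "C \<ge> 0" "b \<ge> 1" and b: "\<And>r. r \<ge> b \<Longrightarrow> \<bar>f r\<bar> \<le> C * r powr s"
    using bigo_powrE[OF assms(1), of 1] by metis
  show ?thesis
  proof (rule bigo_powrI[of b])
    fix r assume "r \<ge> b"
    then have "C * r powr s \<le> C * r powr t"
      using \<open>C \<ge> 0\<close> \<open>b \<ge> 1\<close> \<open>s \<le> t\<close> by (intro mult_left_mono powr_mono) auto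
    then show "\<bar>f r\<bar> \<le> C * r powr t"
      using b[OF \<open>r \<ge> b\<close>] by linarith
  qed
qed

lemma bigo_cmult:
  fixes f :: "real \<Rightarrow> real"
  assumes "f \<in> O[F](g)"
  shows "(\<lambda>r. c * f r) \<in> O[F](g)"
  using assms by (cases "c = 0") auto

lemma bigo_powr_mult:
  fixes f g :: "real \<Rightarrow> real"
  assumes "f \<in> O(\<lambda>r. r powr s)" "g \<in> O(\<lambda>r. r powr t)"
  shows "(\<lambda>r. f r * g r) \<in> O(\<lambda>r. r powr (s + t))"
  using landau_o.big_mult[OF assms] by (simp add: powr_add)

text \<open>Subtracting \<open>C / s * r powr s\<close> leaves a nonincreasing function; as
  \<open>s > 0\<close>, the initial value is absorbed into the growing power. The bound is one-sided
  because it serves a square, whose derivative is controlled only from above.\<close>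

lemma powr_growth_of_deriv_le:
  fixes f f' g :: "real \<Rightarrow> real"
  assumes deriv: "\<And>r. r \<ge> a \<Longrightarrow> (f has_real_derivative f' r) (at r)"
    and le: "\<And>r. r \<ge> a \<Longrightarrow> f' r \<le> g r"
    and g: "g \<in> O(\<lambda>r. r powr (s - 1))"
    and "s > 0"
  shows "\<exists>C b. \<forall>r\<ge>b. f r \<le> C * r powr s"
proof -
  obtain C b where "C \<ge> 0" "b \<ge> a" "b \<ge> 1"
    and b: "\<And>r. r \<ge> b \<Longrightarrow> \<bar>g r\<bar> \<le> C * r powr (s - 1)"
    using bigo_powrE[OF g, of a] by metis
  have "f r \<le> (\<bar>f b\<bar> + C / s) * r powr s" if "r \<ge> b" for r
  proof -
    have "f r - C / s * r powr s \<le> f b - C / s * b powr s"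
    proof (rule antimono_of_deriv_nonpos[where f="\<lambda>r. f r - C / s * r powr s", OF _ _ order_refl that])
      show "((\<lambda>r. f r - C / s * r powr s) has_real_derivative f' t - C * t powr (s - 1)) (at t)"
        if "b \<le> t" for t
        using that \<open>b \<ge> a\<close> \<open>b \<ge> 1\<close> \<open>s > 0\<close>
        by (auto intro!: derivative_eq_intros deriv has_real_derivative_powr)
      show "f' t - C * t powr (s - 1) \<le> 0" if "b \<le> t" for t
        using b[OF that] le[of t] that \<open>b \<ge> a\<close> by linarith
    qed
    moreover have "C / s * b powr s \<ge> 0"
      using \<open>C \<ge> 0\<close> \<open>s > 0\<close> by simp
    moreover have "\<bar>f b\<bar> * 1 \<le> \<bar>f b\<bar> * r powr s"
      using that \<open>b \<ge> 1\<close> \<open>s > 0\<close> by (intro mult_left_mono ge_one_powr_ge_zero) auto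
    ultimately show ?thesis
      by (simp add: distrib_right)
  qed
  then show ?thesis by blast
qed

section \<open>The equation as a system: energy and flux bounds\<close>

text \<open>Here \<open>n\<close> stands for \<open>N - 1\<close>, \<open>v\<close> for \<open>w'\<close>, and \<open>p_flux (q + 1) (w r)\<close> for
  \<open>\<bar>w\<bar>\<^sup>q\<^sup>-\<^sup>1 w\<close>.\<close>

locale radial_solution =
  fixes n p q \<alpha> a :: real and w v \<phi> :: "real \<Rightarrow> real"
  assumes p: "p > 1" and q: "q > 1" and \<alpha>: "\<alpha> > 0" and n: "n \<ge> 0" and a: "a > 0"
    and w_deriv: "\<And>r. r \<ge> a \<Longrightarrow> (w has_real_derivative v r) (at r)"
    and flux: "\<And>r. r \<ge> a \<Longrightarrow> \<phi> r = p_flux p (v r)"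
    and flux_deriv: "\<And>r. r \<ge> a \<Longrightarrow> (\<phi> has_real_derivative
      - (n / r * \<phi> r + r * v r + (\<alpha> * w r + p_flux (q + 1) (w r)))) (at r)"
begin

text \<open>The energy \<open>E\<close> decreases because friction and the term
  \<open>r * v r\<close> only dissipate. Its kinetic part is written in \<open>\<phi>\<close> with
  the conjugate exponent, since \<open>\<phi>\<close> is differentiable while \<open>v\<close> need
  not be.\<close>

lemma bounded:
  obtains M where "M \<ge> 0" "\<And>r. r \<ge> a \<Longrightarrow> \<bar>w r\<bar> \<le> M" "\<And>r. r \<ge> a \<Longrightarrow> \<bar>v r\<bar> \<le> M"
proof -
  define p' where "p' = p / (p - 1)"
  have p': "p' > 1" "(p - 1) * p' = p" using p by (auto simp: p'_def field_simps)
  define E where "E = (\<lambda>r. \<bar>\<phi> r\<bar> powr p' / p' + \<alpha> * (w r)\<^sup>2 / 2 + \<bar>w r\<bar> powr (q + 1) / (q + 1))"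
  have E_deriv: "(E has_real_derivative - (n / r * \<bar>v r\<bar> powr p + r * (v r)\<^sup>2)) (at r)"
    if r: "r \<ge> a" for r
  proof -
    have 1: "((\<lambda>r. \<bar>\<phi> r\<bar> powr p') has_real_derivative p' * p_flux p' (\<phi> r) *
        - (n / r * \<phi> r + r * v r + (\<alpha> * w r + p_flux (q + 1) (w r)))) (at r)"
      using p' by (intro DERIV_chain2[OF has_real_derivative_abs_powr flux_deriv[OF r]]) auto
    have 2: "((\<lambda>r. \<bar>w r\<bar> powr (q + 1)) has_real_derivative
        (q + 1) * p_flux (q + 1) (w r) * v r) (at r)"
      using q by (intro DERIV_chain2[OF has_real_derivative_abs_powr w_deriv[OF r]]) auto
    have 3: "p_flux p' (\<phi> r) = v r"
      using flux[OF r] p_flux_conjugate[OF p] by (simp add: p'_def)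
    have 4: "\<bar>v r\<bar> powr p = v r * \<phi> r"
      using flux[OF r] mult_p_flux by simp
    have 5: "((\<lambda>r. (w r)\<^sup>2) has_real_derivative 2 * w r * v r) (at r)"
      by (auto intro!: derivative_eq_intros w_deriv[OF r])
    define X where "X = - (n / r * \<phi> r + r * v r + (\<alpha> * w r + p_flux (q + 1) (w r)))"
    have "(E has_real_derivative p' * v r * X / p'
        + \<alpha> * (2 * w r * v r) / 2 + (q + 1) * p_flux (q + 1) (w r) * v r / (q + 1)) (at r)"
      unfolding E_def using 1[unfolded 3] 2 5
      by (intro DERIV_add DERIV_cdivide DERIV_cmult) (auto simp: X_def)
    also have "p' * v r * X / p' = v r * X"
      using p' by simp
    also have "(q + 1) * p_flux (q + 1) (w r) * v r / (q + 1) = p_flux (q + 1) (w r) * v r"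
      using q by simp
    also have "v r * X + \<alpha> * (2 * w r * v r) / 2 + p_flux (q + 1) (w r) * v r
        = - (n / r * \<bar>v r\<bar> powr p + r * (v r)\<^sup>2)"
      unfolding 4 X_def by (simp add: power2_eq_square algebra_simps)
    finally show ?thesis .
  qed
  have dissipation: "0 \<le> n / r * \<bar>v r\<bar> powr p + r * (v r)\<^sup>2" if "r \<ge> a" for r
    using that n a by (intro add_nonneg_nonneg mult_nonneg_nonneg divide_nonneg_nonneg) auto
  have E_le: "E r \<le> E a" if "r \<ge> a" for r
    by (rule antimono_of_deriv_nonpos[OF E_deriv _ order_refl that])
      (simp, metis dissipation neg_le_0_iff_le)
  have parts: "\<bar>v r\<bar> powr p \<le> p' * E a" "(w r)\<^sup>2 \<le> 2 * E a / \<alpha>" if r: "r \<ge> a" for r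
  proof -
    have "\<bar>\<phi> r\<bar> powr p' = \<bar>v r\<bar> powr p"
      using flux[OF r] p' by (simp add: abs_p_flux powr_powr)
    then have "\<bar>v r\<bar> powr p / p' + \<alpha> * (w r)\<^sup>2 / 2 + \<bar>w r\<bar> powr (q + 1) / (q + 1) \<le> E a"
      using E_le[OF r] by (simp add: E_def)
    moreover have "0 \<le> \<bar>v r\<bar> powr p / p'" "0 \<le> \<alpha> * (w r)\<^sup>2 / 2"
      "0 \<le> \<bar>w r\<bar> powr (q + 1) / (q + 1)"
      using p' \<alpha> q by auto
    ultimately have "\<bar>v r\<bar> powr p / p' \<le> E a" "\<alpha> * (w r)\<^sup>2 / 2 \<le> E a"
      by linarith+
    then show "\<bar>v r\<bar> powr p \<le> p' * E a" "(w r)\<^sup>2 \<le> 2 * E a / \<alpha>"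
      using p' \<alpha> by (auto simp: field_simps)
  qed
  \<comment> \<open>Turns the bounds on powers of \<open>\<bar>v r\<bar>\<close> and
    \<open>\<bar>w r\<bar>\<close> into bounds on the values themselves.\<close>
  have le_powr: "x \<le> 1 + x powr s" if "x \<ge> 0" "s \<ge> 1" for x s :: real
  proof (cases "x \<ge> 1")
    case True
    then show ?thesis using powr_mono[of 1 s x] that by simp
  qed (use powr_ge_zero[of x s] in linarith)
  show thesis
  proof (rule that[of "1 + p' * E a + (1 + 2 * E a / \<alpha>)"])
    have 0: "0 \<le> p' * E a" "0 \<le> 2 * E a / \<alpha>"
      using parts[of a] order_trans[OF powr_ge_zero] order_trans[OF zero_le_power2] by auto
    then show "0 \<le> 1 + p' * E a + (1 + 2 * E a / \<alpha>)" by linarith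
    show "\<bar>v r\<bar> \<le> 1 + p' * E a + (1 + 2 * E a / \<alpha>)" if "r \<ge> a" for r
      using le_powr[of "\<bar>v r\<bar>" p] parts[OF that] p 0 by linarith
    show "\<bar>w r\<bar> \<le> 1 + p' * E a + (1 + 2 * E a / \<alpha>)" if "r \<ge> a" for r
      using le_powr[of "\<bar>w r\<bar>" 2] parts[OF that] 0 by simp
  qed
qed

lemma source_bound:
  obtains K where "K \<ge> 0" "\<And>r. r \<ge> a \<Longrightarrow> \<bar>p_flux (q + 1) (w r)\<bar> \<le> K * \<bar>w r\<bar>"
proof -
  obtain M where M: "M \<ge> 0" "\<And>r. r \<ge> a \<Longrightarrow> \<bar>w r\<bar> \<le> M"
    using bounded by metis
  show thesis
  proof (rule that[of "M powr (q - 1)"])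
    fix r assume "r \<ge> a"
    then show "\<bar>p_flux (q + 1) (w r)\<bar> \<le> M powr (q - 1) * \<bar>w r\<bar>"
      using M q by (auto simp: p_flux_def abs_mult intro!: mult_right_mono powr_mono2)
  qed simp
qed

text \<open>Only boundedness of \<open>w\<close> enters here; the faster decay coming from
  \<open>q > 1\<close> is exploited in the final convergence step.\<close>

lemma source_bigo:
  assumes "w \<in> O(\<lambda>r. r powr s)"
  shows "(\<lambda>r. p_flux (q + 1) (w r)) \<in> O(\<lambda>r. r powr s)"
proof -
  obtain K where "K \<ge> 0" "\<And>r. r \<ge> a \<Longrightarrow> \<bar>p_flux (q + 1) (w r)\<bar> \<le> K * \<bar>w r\<bar>"
    using source_bound by blast
  then have "(\<lambda>r. p_flux (q + 1) (w r)) \<in> O(w)"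
    by (intro bigoI[of _ K] eventually_mono[OF eventually_ge_at_top[of a]]) auto
  then show ?thesis using assms by (rule landau_o.big.trans)
qed

text \<open>The flux map is odd, so the one-sided barrier estimate applies to \<open>\<phi>\<close>
  and to \<open>- \<phi>\<close> alike.\<close>

lemma flux_bigo:
  assumes "\<gamma> \<ge> 0" "\<gamma> * (p - 2) + p \<ge> 0" and w: "w \<in> O(\<lambda>r. r powr (- \<gamma>))"
  shows "\<phi> \<in> O(\<lambda>r. r powr (- (\<gamma> + 1) * (p - 1)))"
proof -
  define h where "h = (\<lambda>r. \<alpha> * w r + p_flux (q + 1) (w r))"
  have h_bigo: "h \<in> O(\<lambda>r. r powr (- \<gamma>))"
    unfolding h_def using w source_bigo[OF w] by (intro sum_in_bigo) auto
  obtain C b where b: "C \<ge> 0" "b \<ge> a" "b \<ge> 1"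
    and h: "\<And>r. r \<ge> b \<Longrightarrow> \<bar>h r\<bar> \<le> C * r powr (- \<gamma>)"
    using bigo_powrE[OF h_bigo, of a] by metis
  obtain M where M: "M \<ge> 0" "\<And>r. r \<ge> a \<Longrightarrow> \<bar>v r\<bar> \<le> M"
    using bounded by metis
  have deriv: "(\<phi> has_real_derivative - (n / r * \<phi> r + r * v r + h r)) (at r)" if "r \<ge> b" for r
    using flux_deriv[of r] that b by (simp add: h_def)
  have "\<exists>K r0. \<forall>r\<ge>r0. \<phi> r \<le> K * r powr (- (\<gamma> + 1) * (p - 1))"
    by (rule flux_upper_decay[where a=b and M=M and C=C and n=n and v=v and h=h])
      (use p n assms b M flux deriv h in auto)
  then obtain K1 r1 where 1: "\<And>r. r \<ge> r1 \<Longrightarrow> \<phi> r \<le> K1 * r powr (- (\<gamma> + 1) * (p - 1))"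
    by blast
  have "((\<lambda>r. - \<phi> r) has_real_derivative - (n / r * - \<phi> r + r * - v r + - h r)) (at r)"
    if "r \<ge> b" for r
    using DERIV_minus[OF deriv[OF that]] by (simp add: algebra_simps)
  then have "\<exists>K r0. \<forall>r\<ge>r0. - \<phi> r \<le> K * r powr (- (\<gamma> + 1) * (p - 1))"
    by (intro flux_upper_decay[where a=b and M=M and C=C and n=n and v="\<lambda>r. - v r"
          and h="\<lambda>r. - h r" and \<phi>="\<lambda>r. - \<phi> r"])
      (use p n assms b M flux h in auto)
  then obtain K2 r2 where 2: "\<And>r. r \<ge> r2 \<Longrightarrow> - \<phi> r \<le> K2 * r powr (- (\<gamma> + 1) * (p - 1))"
    by blast
  show ?thesis
  proof (rule bigo_powrI[of "max r1 r2" _ "max K1 K2"])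
    fix r assume r: "max r1 r2 \<le> r"
    have "K * r powr (- (\<gamma> + 1) * (p - 1)) \<le> max K1 K2 * r powr (- (\<gamma> + 1) * (p - 1))"
      if "K \<in> {K1, K2}" for K
      using that by (intro mult_right_mono) auto
    from this[of K1] this[of K2] show "\<bar>\<phi> r\<bar> \<le> max K1 K2 * r powr (- (\<gamma> + 1) * (p - 1))"
      using 1[of r] 2[of r] r by auto
  qed
qed

section \<open>The corrected profile \<open>u\<close> and the improvement of decay\<close>

definition u :: "real \<Rightarrow> real" where "u r = w r + \<phi> r / r"

lemma flux_quotient_bigo:
  assumes "\<gamma> \<ge> 0" "\<gamma> * (p - 2) + p \<ge> 0" "w \<in> O(\<lambda>r. r powr (- \<gamma>))"
  shows "(\<lambda>r. \<phi> r / r) \<in> O(\<lambda>r. r powr (- \<gamma> - (\<gamma> * (p - 2) + p)))"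
proof -
  have "(\<lambda>r::real. inverse r) \<in> O(\<lambda>r. r powr (- 1))"
    by (rule bigo_powrI[of 1 _ 1]) (simp add: powr_minus)
  from bigo_powr_mult[OF flux_bigo[OF assms] this] show ?thesis
    by (simp add: divide_inverse algebra_simps)
qed

text \<open>The term \<open>r * v r\<close> coming from \<open>w\<close> cancels against the one in
  the flux equation, so \<open>w'\<close> enters only through \<open>\<phi>\<close>. For
  \<open>\<beta> = \<alpha>\<close>, the case used below, the linear term in \<open>u\<close>
  vanishes as well.\<close>

lemma scaled_u_deriv:
  assumes "r \<ge> a"
  shows "((\<lambda>r. r powr \<beta> * u r) has_real_derivative r powr (\<beta> - 1) *
    ((\<beta> - \<alpha>) * u r + (\<alpha> - n - 1) * (\<phi> r / r) - p_flux (q + 1) (w r))) (at r)"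
proof -
  have "r > 0" using assms a by simp
  define X where "X = - (n / r * \<phi> r + r * v r + (\<alpha> * w r + p_flux (q + 1) (w r)))"
  have "(u has_real_derivative v r + (X * r - \<phi> r * 1) / (r * r)) (at r)"
    unfolding u_def[abs_def] X_def using \<open>r > 0\<close>
    by (intro DERIV_add DERIV_divide w_deriv[OF assms] flux_deriv[OF assms] DERIV_ident) auto
  from DERIV_mult[OF has_real_derivative_powr[OF \<open>r > 0\<close>] this]
  have "((\<lambda>r. r powr \<beta> * u r) has_real_derivative \<beta> * r powr (\<beta> - 1) * u r
      + (v r + (X * r - \<phi> r * 1) / (r * r)) * r powr \<beta>) (at r)" .
  also have "r powr \<beta> = r * r powr (\<beta> - 1)"
    using \<open>r > 0\<close> by (simp add: powr_diff)
  also have "\<beta> * r powr (\<beta> - 1) * u r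
      + (v r + (X * r - \<phi> r * 1) / (r * r)) * (r * r powr (\<beta> - 1)) =
      r powr (\<beta> - 1) * (\<beta> * u r + (r * v r + X - \<phi> r / r))"
    using \<open>r > 0\<close> by (simp add: field_simps)
  also have "\<beta> * u r + (r * v r + X - \<phi> r / r) =
      (\<beta> - \<alpha>) * u r + (\<alpha> - n - 1) * (\<phi> r / r) - p_flux (q + 1) (w r)"
    using \<open>r > 0\<close> by (simp add: u_def X_def field_simps)
  finally show ?thesis .
qed

text \<open>After the good-signed term is dropped, each remaining term in the derivative of the
  weighted square carries one factor \<open>\<phi> r / r\<close>. That factor gains
  \<open>2 * \<epsilon>\<close>, and the square root leaves a gain of \<open>\<epsilon>\<close> for
  \<open>u\<close>.\<close>

lemma decay_improve:
  assumes "\<gamma> \<ge> 0" "\<epsilon> > 0" "\<gamma> + \<epsilon> < \<alpha>" "\<gamma> * (p - 2) + p \<ge> 2 * \<epsilon>"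
    and w: "w \<in> O(\<lambda>r. r powr (- \<gamma>))"
  shows "w \<in> O(\<lambda>r. r powr (- (\<gamma> + \<epsilon>)))"
proof -
  define \<psi> where "\<psi> = (\<lambda>r. \<phi> r / r)"
  define s where "s = (\<lambda>r. p_flux (q + 1) (w r))"
  \<comment> \<open>Growth exponent of \<open>(r powr \<alpha> * u r)\<^sup>2\<close> that matches
    decay of \<open>u\<close> at rate \<open>\<gamma> + \<epsilon>\<close>; it is positive because
    \<open>\<gamma> + \<epsilon> < \<alpha>\<close>.\<close>
  define \<sigma> where "\<sigma> = 2 * (\<alpha> - \<gamma> - \<epsilon>)"
  have \<psi>: "\<psi> \<in> O(\<lambda>r. r powr (- \<gamma> - 2 * \<epsilon>))"
    unfolding \<psi>_def using assms by (intro bigo_powr_mono[OF flux_quotient_bigo[OF _ _ w]]) auto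
  have u: "u \<in> O(\<lambda>r. r powr (- \<gamma>))"
    unfolding u_def using w \<psi> \<open>\<epsilon> > 0\<close>
    by (intro sum_in_bigo bigo_powr_mono[OF \<psi>[unfolded \<psi>_def]]) auto
  define g where "g = (\<lambda>r. 2 * (r powr (2 * \<alpha> - 1) * (\<bar>\<psi> r\<bar> * (\<bar>\<alpha> - n - 1\<bar> * \<bar>u r\<bar> + \<bar>s r\<bar>))))"
  have "(\<lambda>r. \<bar>\<alpha> - n - 1\<bar> * \<bar>u r\<bar> + \<bar>s r\<bar>) \<in> O(\<lambda>r. r powr (- \<gamma>))"
    using u source_bigo[OF w] by (intro sum_in_bigo bigo_cmult) (auto simp: s_def)
  then have "g \<in> O(\<lambda>r. r powr (2 * \<alpha> - 1 + (- \<gamma> - 2 * \<epsilon> + (- \<gamma>))))"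
    unfolding g_def using \<psi> by (intro bigo_cmult bigo_powr_mult) auto
  then have g: "g \<in> O(\<lambda>r. r powr (\<sigma> - 1))"
    by (simp add: \<sigma>_def algebra_simps)
  have "\<exists>C b. \<forall>r\<ge>b. (r powr \<alpha> * u r)\<^sup>2 \<le> C * r powr \<sigma>"
  proof (rule powr_growth_of_deriv_le[OF _ _ g])
    show "\<sigma> > 0" using assms by (simp add: \<sigma>_def)
    fix r assume r: "r \<ge> a"
    show "((\<lambda>r. (r powr \<alpha> * u r)\<^sup>2) has_real_derivative 2 * (r powr \<alpha> * u r) *
      (r powr (\<alpha> - 1) * ((\<alpha> - n - 1) * \<psi> r - s r))) (at r)"
      using DERIV_power[OF scaled_u_deriv[OF r, of \<alpha>], of 2]
      by (simp add: \<psi>_def s_def mult_ac)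
    \<comment> \<open>The factor \<open>u\<close> is kept whole next to \<open>\<psi>\<close> but
      split into \<open>w + \<psi>\<close> next to the source, which exposes
      \<open>w r * s r \<ge> 0\<close>.\<close>
    have "(w r + x) * (c * x - y) = c * (x * (w r + x)) - w r * y - x * y" for c x y
      by (simp add: algebra_simps)
    then have "u r * ((\<alpha> - n - 1) * \<psi> r - s r) = (\<alpha> - n - 1) * (\<psi> r * u r) - w r * s r - \<psi> r * s r"
      unfolding u_def \<psi>_def by blast
    also have "\<dots> \<le> \<bar>\<psi> r\<bar> * (\<bar>\<alpha> - n - 1\<bar> * \<bar>u r\<bar> + \<bar>s r\<bar>)"
    proof -
      have "w r * s r \<ge> 0" by (simp add: s_def mult_p_flux)
      moreover have "(\<alpha> - n - 1) * (\<psi> r * u r) \<le> \<bar>\<psi> r\<bar> * (\<bar>\<alpha> - n - 1\<bar> * \<bar>u r\<bar>)"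
        using abs_ge_self[of "(\<alpha> - n - 1) * (\<psi> r * u r)"] by (simp add: abs_mult mult_ac)
      moreover have "- (\<psi> r * s r) \<le> \<bar>\<psi> r\<bar> * \<bar>s r\<bar>"
        using abs_ge_minus_self[of "\<psi> r * s r"] by (simp add: abs_mult)
      ultimately show ?thesis by (simp add: distrib_left)
    qed
    finally have "r powr (2 * \<alpha> - 1) * (u r * ((\<alpha> - n - 1) * \<psi> r - s r))
        \<le> r powr (2 * \<alpha> - 1) * (\<bar>\<psi> r\<bar> * (\<bar>\<alpha> - n - 1\<bar> * \<bar>u r\<bar> + \<bar>s r\<bar>))"
      by (rule mult_left_mono) simp
    moreover have "r powr (2 * \<alpha> - 1) = r powr \<alpha> * r powr (\<alpha> - 1)"
      by (simp add: powr_add[symmetric])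
    ultimately show "2 * (r powr \<alpha> * u r) * (r powr (\<alpha> - 1) * ((\<alpha> - n - 1) * \<psi> r - s r)) \<le> g r"
      by (simp only: g_def mult_ac mult_le_cancel_left_pos zero_less_numeral)
  qed
  then obtain C b where C: "\<And>r. r \<ge> b \<Longrightarrow> (r powr \<alpha> * u r)\<^sup>2 \<le> C * r powr \<sigma>"
    by blast
  have "u \<in> O(\<lambda>r. r powr (- (\<gamma> + \<epsilon>)))"
  proof (rule bigo_powrI[of "max b 1" _ "sqrt C"])
    fix r assume r: "max b 1 \<le> r"
    have "\<bar>r powr \<alpha> * u r\<bar> \<le> sqrt (C * r powr \<sigma>)"
      using C[of r] r by (intro real_le_rsqrt) auto
    also have "\<dots> = sqrt C * r powr (\<alpha> - \<gamma> - \<epsilon>)"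
      using r by (simp add: real_sqrt_mult \<sigma>_def powr_half_sqrt[symmetric] powr_powr diff_divide_distrib)
    finally have "r powr (- \<alpha>) * (r powr \<alpha> * \<bar>u r\<bar>) \<le>
        r powr (- \<alpha>) * (sqrt C * r powr (\<alpha> - \<gamma> - \<epsilon>))"
      by (intro mult_left_mono) (auto simp: abs_mult)
    moreover have "r powr (- \<alpha>) * r powr \<alpha> = 1" "r powr (- \<alpha>) * r powr (\<alpha> - \<gamma> - \<epsilon>) = r powr (- (\<gamma> + \<epsilon>))"
      using r by (auto simp: powr_add[symmetric])
    ultimately show "\<bar>u r\<bar> \<le> sqrt C * r powr (- (\<gamma> + \<epsilon>))"
      by (simp only: mult.assoc[symmetric] mult.commute[of _ "sqrt C"]) (simp add: mult.assoc)
  qed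
  moreover have "\<psi> \<in> O(\<lambda>r. r powr (- (\<gamma> + \<epsilon>)))"
    using \<open>\<epsilon> > 0\<close> by (intro bigo_powr_mono[OF \<psi>]) auto
  ultimately have "(\<lambda>r. u r - \<psi> r) \<in> O(\<lambda>r. r powr (- (\<gamma> + \<epsilon>)))"
    by (rule sum_in_bigo)
  then show ?thesis by (simp add: u_def \<psi>_def)
qed

text \<open>The gain \<open>x * (p - 2) + p\<close> is affine in \<open>x\<close>, hence bounded
  below on \<open>[0, \<alpha>]\<close> by its smaller endpoint value \<open>\<delta>\<close>. A
  fixed step size therefore works throughout the iteration.\<close>

lemma decay:
  assumes "\<alpha> * (p - 2) + p > 0" "0 < \<gamma>" "\<gamma> < \<alpha>"
  shows "w \<in> O(\<lambda>r. r powr (- \<gamma>))"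
proof -
  define \<delta> where "\<delta> = min p (\<alpha> * (p - 2) + p)"
  have \<delta>: "x * (p - 2) + p \<ge> \<delta>" if "0 \<le> x" "x \<le> \<alpha>" for x
  proof (cases "p \<ge> 2")
    case True
    then show ?thesis using that by (simp add: \<delta>_def)
  next
    case False
    then have "x * (2 - p) \<le> \<alpha> * (2 - p)" using that by (intro mult_right_mono) auto
    then show ?thesis by (auto simp: \<delta>_def min_def algebra_simps)
  qed
  have "\<delta> > 0" using assms p by (simp add: \<delta>_def)
  obtain m :: nat where "m > 2 * \<gamma> / \<delta>"
    using reals_Archimedean2 by blast
  moreover have "2 * \<gamma> / \<delta> > 0" using \<open>\<delta> > 0\<close> assms by simp
  ultimately have m: "real m > 0" "2 * \<gamma> / \<delta> < real m" by linarith+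
  \<comment> \<open>With this step size exactly \<open>m\<close> improvements lead from exponent 0
    to \<open>\<gamma>\<close>, and no intermediate exponent exceeds
    \<open>\<gamma>\<close>.\<close>
  define \<epsilon> where "\<epsilon> = \<gamma> / m"
  have \<epsilon>: "\<epsilon> > 0" "2 * \<epsilon> \<le> \<delta>"
    using m assms \<open>\<delta> > 0\<close> by (auto simp: \<epsilon>_def field_simps)
  have "w \<in> O(\<lambda>r. r powr (- (real k * \<epsilon>)))" if "k \<le> m" for k
    using that
  proof (induction k)
    case 0
    obtain M where "\<And>r. r \<ge> a \<Longrightarrow> \<bar>w r\<bar> \<le> M" using bounded by metis
    then show ?case using a by (intro bigo_powrI[of a _ M]) auto
  next
    case (Suc k)
    have "real (Suc k) * \<epsilon> \<le> real m * \<epsilon>"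
      using Suc.prems \<epsilon> by (intro mult_right_mono) auto
    also have "\<dots> = \<gamma>" using m by (simp add: \<epsilon>_def)
    finally have le: "real k * \<epsilon> + \<epsilon> \<le> \<gamma>" by (simp add: algebra_simps)
    then have "2 * \<epsilon> \<le> real k * \<epsilon> * (p - 2) + p"
      using \<delta>[of "real k * \<epsilon>"] \<epsilon> assms by simp
    then have "w \<in> O(\<lambda>r. r powr (- (real k * \<epsilon> + \<epsilon>)))"
      using Suc le \<epsilon> assms by (intro decay_improve) auto
    then show ?case by (simp add: algebra_simps)
  qed
  from this[of m] show ?thesis using m by (simp add: \<epsilon>_def)
qed

section \<open>Convergence at the critical rate\<close>

theorem converges:
  assumes "\<alpha> * (p - 2) + p > 0"
  shows "\<exists>L. ((\<lambda>r. r powr \<alpha> * w r) \<longlongrightarrow> L) at_top"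
proof -
  define \<delta> where "\<delta> = \<alpha> * (p - 2) + p"
  have "\<delta> > 0" using assms by (simp add: \<delta>_def)
  \<comment> \<open>Above the first threshold \<open>\<gamma> * q > \<alpha>\<close>, so the source
    is integrable against \<open>r powr (\<alpha> - 1)\<close>; above the second the same holds for
    \<open>\<phi> r / r\<close>. The midpoint of \<open>m\<close> and \<open>\<alpha>\<close>
    exceeds both and stays below \<open>\<alpha>\<close>.\<close>
  define m where "m = max (\<alpha> / q) (\<alpha> - \<delta> / (p - 1))"
  define \<gamma> where "\<gamma> = (\<alpha> + m) / 2"
  have "\<alpha> / q < \<alpha>" "\<alpha> / q > 0" "\<delta> / (p - 1) > 0"
    using q \<alpha> p \<open>\<delta> > 0\<close> by (auto simp: field_simps)
  then have "m < \<alpha>" "m \<ge> \<alpha> / q" "m \<ge> \<alpha> - \<delta> / (p - 1)"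
    by (auto simp: m_def)
  have mid: "x < \<gamma>" if "x < \<alpha>" "x \<le> m" for x
    using that by (simp add: \<gamma>_def)
  have \<gamma>: "\<alpha> / q < \<gamma>" "\<alpha> - \<delta> / (p - 1) < \<gamma>" "\<gamma> < \<alpha>"
    using mid[of "\<alpha> / q"] mid[of "\<alpha> - \<delta> / (p - 1)"] \<open>\<alpha> / q < \<alpha>\<close> \<open>\<alpha> / q > 0\<close>
      \<open>\<delta> / (p - 1) > 0\<close> \<open>m < \<alpha>\<close> \<open>m \<ge> \<alpha> / q\<close> \<open>m \<ge> \<alpha> - \<delta> / (p - 1)\<close>
    by (auto simp: \<gamma>_def)
  then have "0 < \<gamma>"
    using \<open>\<alpha> / q > 0\<close> by linarith
  have gap1: "\<gamma> * q - \<alpha> > 0"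
    using \<gamma>(1) q by (simp add: field_simps)
  have "(\<alpha> - \<gamma>) * (p - 1) < \<delta>"
    using \<gamma>(2) p by (simp add: field_simps)
  then have gap2: "\<gamma> + (\<gamma> * (p - 2) + p) - \<alpha> > 0"
    by (simp add: \<delta>_def algebra_simps)
  define \<eta> where "\<eta> = min (\<gamma> * q - \<alpha>) (\<gamma> + (\<gamma> * (p - 2) + p) - \<alpha>)"
  have "\<eta> > 0" using gap1 gap2 by (simp add: \<eta>_def)
  have w: "w \<in> O(\<lambda>r. r powr (- \<gamma>))"
    using decay assms \<gamma> \<open>0 < \<gamma>\<close> by blast
  have "(\<lambda>r. \<phi> r / r) \<in> O(\<lambda>r. r powr (- \<gamma> - (\<gamma> * (p - 2) + p)))"
    using \<open>0 < \<gamma>\<close> \<gamma> gap2 by (intro flux_quotient_bigo w) auto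
  then have \<psi>: "(\<lambda>r. \<phi> r / r) \<in> O(\<lambda>r. r powr (- \<alpha> - \<eta>))"
    by (rule bigo_powr_mono) (auto simp: \<eta>_def)
  have source: "(\<lambda>r. p_flux (q + 1) (w r)) \<in> O(\<lambda>r. r powr (- \<alpha> - \<eta>))"
  proof -
    obtain C b where C: "C \<ge> 0" "b \<ge> 1" "\<And>r. r \<ge> b \<Longrightarrow> \<bar>w r\<bar> \<le> C * r powr (- \<gamma>)"
      using bigo_powrE[OF w, of 1] by metis
    have "(\<lambda>r. p_flux (q + 1) (w r)) \<in> O(\<lambda>r. r powr (- \<gamma> * q))"
    proof (rule bigo_powrI[of b _ "C powr q"])
      fix r assume "r \<ge> b"
      then have "\<bar>w r\<bar> powr q \<le> (C * r powr (- \<gamma>)) powr q"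
        using C q by (intro powr_mono2) auto
      then show "\<bar>p_flux (q + 1) (w r)\<bar> \<le> C powr q * r powr (- \<gamma> * q)"
        using C by (simp add: abs_p_flux powr_mult powr_powr)
    qed
    then show ?thesis by (rule bigo_powr_mono) (auto simp: \<eta>_def)
  qed
  define d where "d = (\<lambda>r. r powr (\<alpha> - 1) * ((\<alpha> - n - 1) * (\<phi> r / r) - p_flux (q + 1) (w r)))"
  have "d \<in> O(\<lambda>r. r powr (\<alpha> - 1 + (- \<alpha> - \<eta>)))"
    unfolding d_def using \<psi> source
    by (intro bigo_powr_mult sum_in_bigo bigo_cmult) auto
  then have d: "d \<in> O(\<lambda>r. r powr (- 1 - \<eta>))" by (simp add: algebra_simps)
  obtain C b where "C \<ge> 0" "b \<ge> a" "b \<ge> 1"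
    and "\<And>r. r \<ge> b \<Longrightarrow> \<bar>d r\<bar> \<le> C * r powr (- 1 - \<eta>)"
    using bigo_powrE[OF d, of a] by metis
  then obtain L where L: "((\<lambda>r. r powr \<alpha> * u r) \<longlongrightarrow> L) at_top"
    using convergent_of_deriv_bound[of b \<eta> C "\<lambda>r. r powr \<alpha> * u r" d]
      scaled_u_deriv[of _ \<alpha>] \<open>\<eta> > 0\<close> by (auto simp: d_def)
  \<comment> \<open>The correction in \<open>u\<close> vanishes even after scaling, so
    \<open>w\<close> inherits the limit of \<open>u\<close>.\<close>
  have "(\<lambda>r. r powr \<alpha> * (\<phi> r / r)) \<in> O(\<lambda>r. r powr (\<alpha> + (- \<alpha> - \<eta>)))"
    by (intro bigo_powr_mult \<psi>) auto
  also have "(\<lambda>r. r powr (\<alpha> + (- \<alpha> - \<eta>))) \<in> o(\<lambda>_::real. 1)"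
    using tendsto_neg_powr[OF _ filterlim_ident, of "- \<eta>"] \<open>\<eta> > 0\<close>
    by (intro smalloI_tendsto) auto
  finally have "((\<lambda>r. r powr \<alpha> * (\<phi> r / r)) \<longlongrightarrow> 0) at_top"
    using smalloD_tendsto by fastforce
  from tendsto_diff[OF L this] show ?thesis
    by (auto simp: u_def algebra_simps)
qed

end

section \<open>Transfer to solutions of (E)\<close>

theorem proposition3p1:
  fixes N :: nat and p q \<alpha> :: real and w :: "real \<Rightarrow> real"
  assumes "N \<ge> 1" and "p > 1" and "q > 1" and "\<alpha> > 0"
    and "p > 2 \<or> (p < 2 \<and> \<alpha> < p / (2 - p))"
    and "is_solution N p q \<alpha> w"
  shows "\<exists>L::real. ((\<lambda>r. r powr \<alpha> * w r) \<longlongrightarrow> L) at_top"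
proof -
  obtain R where "R \<ge> 0" and R: "solution_on_ray N p q \<alpha> R w"
    using assms(6) by (auto simp: is_solution_def)
  define \<phi> where "\<phi> = (\<lambda>r. p_flux p (deriv w r))"
  \<comment> \<open>Starting at \<open>R + 1\<close> keeps the closed ray inside the open domain and
    its left end positive, even when \<open>R = 0\<close>.\<close>
  have "radial_solution (real N - 1) p q \<alpha> (R + 1) w (deriv w) \<phi>"
  proof
    fix r assume "r \<ge> R + 1"
    then have "r > R" by simp
    then have "w differentiable at r" "\<phi> differentiable at r"
      using R unfolding solution_on_ray_def C1_differentiable_on_eq \<phi>_def by auto
    moreover have "deriv \<phi> r + (real N - 1) / r * \<phi> r + r * deriv w r + \<alpha> * w r
        + \<bar>w r\<bar> powr (q - 1) * w r = 0"
      using R \<open>r > R\<close> by (simp add: solution_on_ray_def \<phi>_def)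
    then have "deriv \<phi> r = - ((real N - 1) / r * \<phi> r + r * deriv w r
        + (\<alpha> * w r + p_flux (q + 1) (w r)))"
      by (simp add: p_flux_def[of "q + 1"])
    ultimately show "(w has_real_derivative deriv w r) (at r)"
      "(\<phi> has_real_derivative - ((real N - 1) / r * \<phi> r + r * deriv w r
        + (\<alpha> * w r + p_flux (q + 1) (w r)))) (at r)"
      using DERIV_deriv_iff_real_differentiable by metis+
  qed (use assms \<open>R \<ge> 0\<close> in \<open>auto simp: \<phi>_def\<close>)
  \<comment> \<open>Both alternatives of the hypothesis reduce to this one inequality; for
    \<open>p < 2\<close> it is the bound on \<open>\<alpha>\<close> with the denominator
    cleared.\<close>
  moreover have "\<alpha> * (p - 2) + p > 0"
    using assms(5)
  proof
    assume "p > 2"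
    then show ?thesis using \<open>\<alpha> > 0\<close> by (intro add_pos_pos mult_pos_pos) auto
  next
    assume "p < 2 \<and> \<alpha> < p / (2 - p)"
    then have "\<alpha> * (2 - p) < p"
      using pos_less_divide_eq[of "2 - p" \<alpha> p] by auto
    then show ?thesis by (simp add: algebra_simps)
  qed
  ultimately show ?thesis
    by (rule radial_solution.converges)
qed

end
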